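(* Let $d,m,k\in\mathbb{N}$ with $1\le k\le m$, let $a_1,\ldots,a_m$ be distinct points of $\mathbb{R}^d$, and let $F\subset\mathbb{R}^d$ be a nonempty compact convex set with $0\in\operatorname{int}(F)$. Then the global optimal solution set $S_k^F\subset\mathbb{R}^{dk}$ of the problem $$\min\Big\{f_k^F(x)=\max_{1\le i\le m}\Big(\min_{1\le \ell\le k}\rho_F(x_\ell-a_i)\Big)\ \Big|\ x=(x_1,\ldots,x_k)\in\mathbb{R}^{dk}\Big\}$$ is nonempty and closed.
   Context: $\mathbb{R}^d$ is equipped with the Euclidean norm and $\mathbb{R}^{dk}$ is identified with $(\mathbb{R}^d)^k$. The Minkowski gauge function $\rho_F:\mathbb{R}^d\to[0,\infty)$ of $F$ is $\rho_F(x)=\inf\{t\ge 0\mid x\in tF\}$. $S_k^F$ denotes the set of all $\bar x\in\mathbb{R}^{dk}$ such that $f_k^F(\bar x)\le f_k^F(x)$ for all $x\in\mathbb{R}^{dk}$. *)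

theory Defs
  imports "HOL-Analysis.Analysis"
begin

text \<open>The set below is nonempty (so that \<^term>\<open>Inf\<close> is the true infimum) whenever
  \<open>0\<close> is an interior point of \<open>F\<close>.\<close>

definition minkowski_gauge :: "(real ^ 'd) set \<Rightarrow> real ^ 'd \<Rightarrow> real" where
  "minkowski_gauge F x = Inf {t. t \<ge> 0 \<and> x \<in> (\<lambda>y. t *\<^sub>R y) ` F}"

text \<open>The space of \<open>k\<close>-tuples of points of \<open>\<real>\<^sup>d\<close> is the Euclidean space
  \<^typ>\<open>real ^ 'd ^ 'k\<close> with \<open>k = CARD('k)\<close>; the tuple entry with index \<open>l\<close> is \<open>x $ l\<close>.\<close>

definition kcenter_objective ::
    "nat \<Rightarrow> (nat \<Rightarrow> real ^ 'd) \<Rightarrow> (real ^ 'd) set \<Rightarrow> real ^ 'd ^ 'k \<Rightarrow> real" where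
  "kcenter_objective m a F x =
     (MAX i\<in>{1..m}. MIN l\<in>UNIV. minkowski_gauge F (x $ l - a i))"

definition kcenter_solutions ::
    "nat \<Rightarrow> (nat \<Rightarrow> real ^ 'd) \<Rightarrow> (real ^ 'd) set \<Rightarrow> (real ^ 'd ^ 'k) set" where
  "kcenter_solutions m a F =
     {z. \<forall>x :: real ^ 'd ^ 'k. kcenter_objective m a F z \<le> kcenter_objective m a F x}"

end

theory Submission
  imports Defs
begin

text \<open>The objective is continuous but not coercive, since a centre that serves no point may move
  to infinity freely. Let \<open>M\<close> be the objective value at the origin. If a tuple has value at most \<open>M\<close>,
  then each \<open>a i\<close> is served by a centre at gauge distance at most \<open>M\<close>, so centres outside
  a suitable ball serve no point and can be moved to \<open>0\<close> without increasing the objective.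
  Hence the minimum over a compact set of tuples is a global minimum.\<close>

text \<open>The set under the infimum gets a name so that its nonemptiness can be a hypothesis:
  \<open>Inf\<close> of the empty set of reals carries no information.\<close>

definition dilation_factors :: "(real ^ 'd) set \<Rightarrow> real ^ 'd \<Rightarrow> real set" where
  "dilation_factors F x = {t. t \<ge> 0 \<and> x \<in> (\<lambda>y. t *\<^sub>R y) ` F}"

lemma minkowski_gauge_eq_Inf: "minkowski_gauge F x = Inf (dilation_factors F x)"
  by (simp add: minkowski_gauge_def dilation_factors_def)

lemma bdd_below_dilation_factors: "bdd_below (dilation_factors F x)"
  by (rule bdd_belowI[of _ 0]) (simp add: dilation_factors_def)

text \<open>Rescaling a nonzero \<open>x\<close> to norm \<open>r\<close> puts it into the ball
  inside \<open>F\<close>. This also shows that the set of factors is never empty.\<close>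

lemma norm_div_in_dilation_factors:
  assumes "cball 0 r \<subseteq> F" "r > 0"
  shows "norm x / r \<in> dilation_factors F x"
proof (cases "x = 0")
  case True
  have "0 \<in> F" using assms by auto
  then show ?thesis using True by (auto simp: dilation_factors_def)
next
  case False
  have "(r / norm x) *\<^sub>R x \<in> F" using assms False by (intro subsetD[OF assms(1)]) simp
  moreover have "x = (norm x / r) *\<^sub>R ((r / norm x) *\<^sub>R x)" using False assms by simp
  ultimately show ?thesis using assms(2) unfolding dilation_factors_def by fastforce
qed

text \<open>Dividing \<open>s *\<^sub>R u + t *\<^sub>R v\<close> by \<open>s + t\<close> leaves a
  convex combination of \<open>u\<close> and \<open>v\<close>, which stays in
  \<open>F\<close>.\<close>

lemma add_in_dilation_factors:
  assumes "convex F" "s \<in> dilation_factors F x" "t \<in> dilation_factors F y"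
  shows "s + t \<in> dilation_factors F (x + y)"
proof -
  obtain u v where uv: "u \<in> F" "v \<in> F" "x = s *\<^sub>R u" "y = t *\<^sub>R v" "s \<ge> 0" "t \<ge> 0"
    using assms(2,3) by (auto simp: dilation_factors_def)
  show ?thesis
  proof (cases "s + t = 0")
    \<comment> \<open>The weights would divide by zero here, but both vectors vanish, and
      \<open>u\<close> serves as the witness in \<open>F\<close>.\<close>
    case True
    then have "s = 0" "t = 0" using uv by auto
    then show ?thesis using uv by (auto simp: dilation_factors_def)
  next
    case False
    define w where "w = (s / (s + t)) *\<^sub>R u + (t / (s + t)) *\<^sub>R v"
    have "w \<in> F" unfolding w_def
      using uv False by (intro convexD[OF assms(1)]) (auto simp: add_divide_distrib[symmetric])
    moreover have "x + y = (s + t) *\<^sub>R w"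
      using False uv by (simp add: w_def scaleR_add_right)
    ultimately show ?thesis using uv by (auto simp: dilation_factors_def)
  qed
qed

lemma minkowski_gauge_le_norm:
  assumes "cball 0 r \<subseteq> F" "r > 0"
  shows "minkowski_gauge F x \<le> norm x / r"
  unfolding minkowski_gauge_eq_Inf
  by (intro cInf_lower norm_div_in_dilation_factors assms bdd_below_dilation_factors)

text \<open>Since \<open>F\<close> lies in the ball of radius \<open>R\<close>, each factor is at
  least \<open>norm x / R\<close>, and this lower bound passes to the infimum.\<close>

lemma norm_le_minkowski_gauge:
  assumes "F \<subseteq> cball 0 R" "R > 0" "dilation_factors F x \<noteq> {}"
  shows "norm x \<le> R * minkowski_gauge F x"
proof -
  have "norm x / R \<le> t" if "t \<in> dilation_factors F x" for t
  proof -
    obtain u where u: "u \<in> F" "x = t *\<^sub>R u" "t \<ge> 0"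
      using \<open>t \<in> _\<close> by (auto simp: dilation_factors_def)
    then have "norm u \<le> R" using assms(1) by auto
    then have "t * norm u \<le> t * R" using u by (intro mult_left_mono)
    then show ?thesis using u assms(2) by (simp add: divide_le_eq)
  qed
  then have "norm x / R \<le> minkowski_gauge F x"
    unfolding minkowski_gauge_eq_Inf using assms(3) by (intro cInf_greatest)
  then show ?thesis using assms(2) by (simp add: divide_le_eq mult.commute)
qed

lemma minkowski_gauge_triangle:
  assumes "convex F" "dilation_factors F x \<noteq> {}" "dilation_factors F y \<noteq> {}"
  shows "minkowski_gauge F (x + y) \<le> minkowski_gauge F x + minkowski_gauge F y"
proof -
  have *: "minkowski_gauge F (x + y) \<le> s + t"
    if "s \<in> dilation_factors F x" "t \<in> dilation_factors F y" for s t
    unfolding minkowski_gauge_eq_Inf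
    by (intro cInf_lower add_in_dilation_factors assms that bdd_below_dilation_factors)
  \<comment> \<open>The infimum is taken in one variable at a time: over \<open>t\<close> with
    \<open>s\<close> fixed, then over \<open>s\<close>.\<close>
  have "minkowski_gauge F (x + y) - s \<le> minkowski_gauge F y"
    if "s \<in> dilation_factors F x" for s
    unfolding minkowski_gauge_eq_Inf[of F y]
    using assms(3) *[OF that] by (intro cInf_greatest) (auto simp: algebra_simps)
  then have "minkowski_gauge F (x + y) - minkowski_gauge F y \<le> minkowski_gauge F x"
    unfolding minkowski_gauge_eq_Inf[of F x]
    using assms(2) by (intro cInf_greatest) (auto simp: algebra_simps)
  then show ?thesis by simp
qed

text \<open>Subadditivity together with the bound \<open>norm x / r\<close> makes the gauge
  Lipschitz with constant \<open>1 / r\<close>.\<close>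

lemma continuous_on_minkowski_gauge:
  assumes "convex F" "0 \<in> interior F"
  shows "continuous_on UNIV (minkowski_gauge F)"
proof -
  obtain r where r: "r > 0" "cball 0 r \<subseteq> F" using assms(2) by (auto simp: mem_interior_cball)
  have ne: "dilation_factors F x \<noteq> {}" for x
    using norm_div_in_dilation_factors[OF r(2,1)] by blast
  have le: "minkowski_gauge F x - minkowski_gauge F y \<le> norm (x - y) / r" for x y
    using minkowski_gauge_triangle[OF assms(1) ne ne, of "x - y" y]
      minkowski_gauge_le_norm[OF r(2,1), of "x - y"] by simp
  have "(1 / r)-lipschitz_on UNIV (minkowski_gauge F)"
  proof (rule lipschitz_onI)
    fix x y
    show "dist (minkowski_gauge F x) (minkowski_gauge F y) \<le> 1 / r * dist x y"
      \<comment> \<open>\<open>F\<close> may be asymmetric, so the one-sided estimate is used in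
        both orders.\<close>
      using le[of x y] le[of y x] by (simp add: dist_norm norm_minus_commute abs_le_iff)
  qed (use r in simp)
  then show ?thesis by (rule lipschitz_on_continuous_on)
qed

lemma continuous_on_MAX_finite:
  fixes f :: "'i \<Rightarrow> 'a::topological_space \<Rightarrow> real"
  assumes "finite I" "I \<noteq> {}" "\<And>i. i \<in> I \<Longrightarrow> continuous_on S (f i)"
  shows "continuous_on S (\<lambda>x. MAX i\<in>I. f i x)"
  using assms by (induction I rule: finite_ne_induct) (auto intro!: continuous_intros)

lemma continuous_on_MIN_finite:
  fixes f :: "'i \<Rightarrow> 'a::topological_space \<Rightarrow> real"
  assumes "finite I" "I \<noteq> {}" "\<And>i. i \<in> I \<Longrightarrow> continuous_on S (f i)"
  shows "continuous_on S (\<lambda>x. MIN i\<in>I. f i x)"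
  using assms by (induction I rule: finite_ne_induct) (auto intro!: continuous_intros)

lemma continuous_on_kcenter_objective:
  assumes "convex F" "0 \<in> interior F" "m \<ge> 1"
  shows "continuous_on UNIV (kcenter_objective m a F :: real ^ 'd ^ 'k::finite \<Rightarrow> real)"
  unfolding kcenter_objective_def using assms
  by (intro continuous_on_MAX_finite continuous_on_MIN_finite
      continuous_on_compose2[OF continuous_on_minkowski_gauge] continuous_intros) auto

lemma kcenter_objective_le_iff:
  fixes x :: "real ^ 'd ^ 'k::finite"
  assumes "m \<ge> 1"
  shows "kcenter_objective m a F x \<le> c \<longleftrightarrow>
    (\<forall>i\<in>{1..m}. \<exists>l. minkowski_gauge F (x $ l - a i) \<le> c)"
  using assms by (auto simp: kcenter_objective_def Min_le_iff)

text \<open>For each \<open>a i\<close>, a centre serving it within the objective value lies at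
  distance at most \<open>R * M\<close> from it. Its norm is thus at most \<open>A + R * M\<close>,
  so the truncation leaves it in place.\<close>

lemma kcenter_objective_reduce_to_bounded:
  fixes x :: "real ^ 'd ^ 'k::finite"
  assumes "m \<ge> 1" "F \<subseteq> cball 0 R" "R > 0" "\<And>y. dilation_factors F y \<noteq> {}"
    and "\<And>i. i \<in> {1..m} \<Longrightarrow> norm (a i) \<le> A"
    and "kcenter_objective m a F x \<le> M"
  shows "kcenter_objective m a F
    (\<chi> l. if norm (x $ l) \<le> A + R * M then x $ l else 0) \<le> kcenter_objective m a F x"
  unfolding kcenter_objective_le_iff[OF assms(1)]
proof
  fix i assume i: "i \<in> {1..m}"
  obtain l where l: "minkowski_gauge F (x $ l - a i) \<le> kcenter_objective m a F x"
    using kcenter_objective_le_iff[OF assms(1), of a F x "kcenter_objective m a F x"] i by blast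
  have "norm (x $ l - a i) \<le> R * minkowski_gauge F (x $ l - a i)"
    by (rule norm_le_minkowski_gauge[OF assms(2-4)])
  also have "\<dots> \<le> R * M" using l assms(3,6) by (intro mult_left_mono) auto
  finally have "norm (x $ l) \<le> A + R * M"
    using assms(5)[OF i] norm_triangle_sub[of "x $ l" "a i"] by linarith
  then show "\<exists>l. minkowski_gauge F
      ((\<chi> l. if norm (x $ l) \<le> A + R * M then x $ l else 0) $ l - a i)
      \<le> kcenter_objective m a F x"
    using l by (intro exI[of _ l]) simp
qed

lemma compact_tuples_in_cball:
  "compact {x :: real ^ 'd ^ 'k::finite. \<forall>l. norm (x $ l) \<le> B}"
proof (rule compact_eq_bounded_closed[THEN iffD2, OF conjI])
  have "norm x \<le> (\<Sum>l\<in>(UNIV :: 'k set). B)" if "\<forall>l. norm (x $ l) \<le> B" for x :: "real ^ 'd ^ 'k"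
  proof -
    have "norm x \<le> (\<Sum>l\<in>UNIV. norm (x $ l))" by (simp add: norm_vec_def L2_set_le_sum)
    also have "\<dots> \<le> (\<Sum>l\<in>(UNIV :: 'k set). B)" using that by (intro sum_mono) simp
    finally show ?thesis .
  qed
  then show "bounded {x :: real ^ 'd ^ 'k. \<forall>l. norm (x $ l) \<le> B}"
    unfolding bounded_iff by blast
  show "closed {x :: real ^ 'd ^ 'k. \<forall>l. norm (x $ l) \<le> B}"
    by (intro closed_Collect_all closed_Collect_le continuous_intros)
qed

text \<open>The solution set is an intersection of closed sublevel sets of the continuous objective,
  one for each competitor \<open>x\<close>.\<close>

lemma closed_kcenter_solutions:
  assumes "convex F" "0 \<in> interior F" "m \<ge> 1"
  shows "closed (kcenter_solutions m a F :: (real ^ 'd ^ 'k::finite) set)"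
  unfolding kcenter_solutions_def
  by (intro closed_Collect_all closed_Collect_le continuous_on_kcenter_objective assms
      continuous_intros)

lemma kcenter_solutions_nonempty:
  assumes "compact F" "convex F" "0 \<in> interior F" "m \<ge> 1"
  shows "(kcenter_solutions m a F :: (real ^ 'd ^ 'k::finite) set) \<noteq> {}"
proof -
  let ?f = "kcenter_objective m a F :: real ^ 'd ^ 'k \<Rightarrow> real"
  obtain r where r: "r > 0" "cball 0 r \<subseteq> F" using assms(3) by (auto simp: mem_interior_cball)
  have ne: "dilation_factors F x \<noteq> {}" for x
    using norm_div_in_dilation_factors[OF r(2,1)] by blast
  obtain R where R: "R > 0" "F \<subseteq> cball 0 R"
    using compact_imp_bounded[OF assms(1)] by (auto simp: bounded_pos subset_iff)
  define A where "A = (\<Sum>i\<in>{1..m}. norm (a i))"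
  have A: "norm (a i) \<le> A" if "i \<in> {1..m}" for i
    unfolding A_def using that by (intro member_le_sum) auto
  \<comment> \<open>The truncation radius for \<open>M = ?f 0\<close>; the origin is the reference
    tuple.\<close>
  define B where "B = A + R * ?f 0"
  let ?K = "{x :: real ^ 'd ^ 'k. \<forall>l. norm (x $ l) \<le> B}"
  have shrink: "?f (\<chi> l. if norm (x $ l) \<le> B then x $ l else 0) \<le> ?f x"
    if "?f x \<le> ?f 0" for x
    unfolding B_def
    by (rule kcenter_objective_reduce_to_bounded[OF assms(4) R(2,1) ne A that])
  \<comment> \<open>This puts the origin, and the default entry 0 of truncated tuples, within the
    bound that defines \<open>?K\<close>.\<close>
  have "0 \<le> B"
  proof -
    obtain l :: 'k where "minkowski_gauge F (0 - a 1) \<le> ?f 0"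
      using kcenter_objective_le_iff[OF assms(4), of a F "0 :: real ^ 'd ^ 'k" "?f 0"] assms(4)
      by auto
    then have "R * minkowski_gauge F (- a 1) \<le> R * ?f 0"
      using R by (intro mult_left_mono) auto
    then have "0 \<le> R * ?f 0"
      using norm_le_minkowski_gauge[OF R(2,1) ne, of "- a 1"] norm_ge_zero[of "- a 1"] by linarith
    then show ?thesis by (simp add: B_def A_def sum_nonneg)
  qed
  then have "0 \<in> ?K" by simp
  moreover have "continuous_on ?K ?f"
    using continuous_on_kcenter_objective[OF assms(2-4)] by (rule continuous_on_subset) simp
  ultimately obtain z where z: "z \<in> ?K" "\<And>x. x \<in> ?K \<Longrightarrow> ?f z \<le> ?f x"
    using continuous_attains_inf[OF compact_tuples_in_cball, of B ?f] by blast
  \<comment> \<open>A tuple no worse than the origin is compared with \<open>z\<close> through its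
    truncation in \<open>?K\<close>; any other tuple is already beaten by the origin.\<close>
  have "?f z \<le> ?f x" for x
  proof (cases "?f x \<le> ?f 0")
    case True
    have "(\<chi> l. if norm (x $ l) \<le> B then x $ l else 0) \<in> ?K" using \<open>0 \<le> B\<close> by simp
    then show ?thesis using z(2) shrink[OF True] order_trans by blast
  next
    case False
    then show ?thesis using z(2)[OF \<open>0 \<in> ?K\<close>] by simp
  qed
  then show ?thesis unfolding kcenter_solutions_def by blast
qed

theorem theorem2p2:
  fixes m k :: nat
    and a :: "nat \<Rightarrow> real ^ 'd"
    and F :: "(real ^ 'd) set"
  assumes "CARD('k::finite) = k"
    and "1 \<le> k" and "k \<le> m"
    and "inj_on a {1..m}"
    and "F \<noteq> {}" and "compact F" and "convex F" and "0 \<in> interior F"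
  shows "(kcenter_solutions m a F :: (real ^ 'd ^ 'k) set) \<noteq> {}
    \<and> closed (kcenter_solutions m a F :: (real ^ 'd ^ 'k) set)"
proof -
  \<comment> \<open>The maximum in the objective then ranges over a nonempty index set.\<close>
  have "1 \<le> m" using assms(2,3) by simp
  then show ?thesis
    using kcenter_solutions_nonempty closed_kcenter_solutions assms(6-8) by blast
qed

end
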